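(* Let $h>0$ and $\mu>0$. Let $G$ be the Laplace lattice Green's function on $\mathbb Z^2$ and let $H:\mathbb Z^2\to\mathbb R$ be a biharmonic lattice Green's function, satisfying $LH=G$. Then the MAC Stokes (velocity) lattice Green's function is $$\mathcal S(m_1,m_2)=-\frac1\mu\begin{bmatrix} D_{yy}H(m_1,m_2) & -D_y^+D_x^+H(m_1,m_2-1)\\ -D_y^+D_x^+H(m_1-1,m_2) & D_{xx}H(m_1,m_2)\end{bmatrix},$$ and the associated pressure lattice Green's function is $$\mathcal P(m_1,m_2)=\frac1h\begin{bmatrix} D_x^-G(m_1,m_2)\\ D_y^-G(m_1,m_2)\end{bmatrix}.$$ The first column of $\mathcal S$ gives the velocity generated by a unit force in the $x$-direction at a horizontal velocity node, and the second column gives the velocity generated by a unit force in the $y$-direction at a vertical velocity node. Explicitly: (1) the fields $u_{m_1+1/2,m_2}=\mathcal S_{11}(m_1,m_2)$, $v_{m_1,m_2+1/2}=\mathcal S_{21}(m_1,m_2)$, $p_{m_1,m_2}=\mathcal P_1(m_1,m_2)$ solve the MAC Stokes equations on the whole lattice with a unit force in the $x$-direction at the horizontal velocity node $(1/2,0)$; (2) the fields $u_{m_1+1/2,m_2}=\mathcal S_{12}(m_1,m_2)$, $v_{m_1,m_2+1/2}=\mathcal S_{22}(m_1,m_2)$, $p_{m_1,m_2}=\mathcal P_2(m_1,m_2)$ solve the MAC Stokes equations on the whole lattice with a unit force in the $y$-direction at the vertical velocity node $(0,1/2)$.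
   Context: Difference operators. For $\phi:\mathbb Z^2\to\mathbb R$ (and likewise for functions on shifted copies of $\mathbb Z^2$): $D_x^+\phi(m_1,m_2)=\phi(m_1+1,m_2)-\phi(m_1,m_2)$, $D_x^-\phi(m_1,m_2)=\phi(m_1,m_2)-\phi(m_1-1,m_2)$, $D_{xx}\phi(m_1,m_2)=\phi(m_1+1,m_2)-2\phi(m_1,m_2)+\phi(m_1-1,m_2)$; $D_y^\pm$ and $D_{yy}$ are the same operators in the second index. $L=D_{xx}+D_{yy}$ is the unscaled five-point operator, with Fourier symbol $\lambda(\theta)=2\cos\theta_1+2\cos\theta_2-4$. Laplace lattice Green's function. Formally $G(m)=\frac1{4\pi^2}\,\mathrm{f.p.}\!\int_{[-\pi,\pi]^2}\frac{e^{i m\cdot\theta}}{\lambda(\theta)}\,d\theta$ (finite part); it is fixed up to an additive constant, and its normalized representative is $G_{\rm reg}(m)=\frac1{4\pi^2}\int_{[-\pi,\pi]^2}\frac{e^{i m\cdot\theta}-1}{\lambda(\theta)}\,d\theta$, with $G_{\rm reg}(0)=0$. It satisfies $LG=\delta$, with $\delta(0)=1$ and $\delta(m)=0$ for $m\ne0$. Biharmonic lattice Green's function. Formally $H(m)=\frac1{4\pi^2}\,\mathrm{f.p.}\!\int_{[-\pi,\pi]^2}\frac{e^{im\cdot\theta}}{\lambda(\theta)^2}\,d\theta$. It is used through the relation $LH=G$ (in the distributional lattice sense). Different regularizations of $G$ and $H$ change only the pressure and velocity reference gauges, so "the" lattice Green's function is understood for the chosen representatives. MAC Stokes equations. The horizontal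 velocity $u$ lives at nodes $(m_1+1/2,m_2)$, the vertical velocity $v$ at nodes $(m_1,m_2+1/2)$, and the pressure $p$ at cell centers $(m_1,m_2)$, with $(m_1,m_2)\in\mathbb Z^2$. With body force $(f^u,f^v)$ and grid spacing $h$ the equations are $$-\mu Lu_{m_1+1/2,m_2}+h(p_{m_1+1,m_2}-p_{m_1,m_2})=h^2f^u_{m_1+1/2,m_2},$$ $$-\mu Lv_{m_1,m_2+1/2}+h(p_{m_1,m_2+1}-p_{m_1,m_2})=h^2f^v_{m_1,m_2+1/2},$$ $$u_{m_1+1/2,m_2}-u_{m_1-1/2,m_2}+v_{m_1,m_2+1/2}-v_{m_1,m_2-1/2}=0.$$ A unit force in the $x$-direction at the node $(1/2,0)$ means that $h^2f^u$ equals $1$ at $(1/2,0)$ and $0$ at all other horizontal velocity nodes, and $f^v\equiv0$. A unit force in the $y$-direction at $(0,1/2)$ means that $h^2f^v$ equals $1$ at $(0,1/2)$ and $0$ at all other vertical velocity nodes, and $f^u\equiv0$. *)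

theory Defs
  imports "HOL-Analysis.Analysis"
begin

text \<open>
  The difference operators are polymorphic in the coordinate type, so that they apply both to
  functions on the integer lattice (coordinates of type \<open>int\<close>) and to functions on its copies
  shifted by a half (coordinates of type \<open>real\<close>).
\<close>

definition Dxp :: "('i::ring_1 \<Rightarrow> 'i \<Rightarrow> real) \<Rightarrow> 'i \<Rightarrow> 'i \<Rightarrow> real" where
  "Dxp \<phi> x y = \<phi> (x + 1) y - \<phi> x y"

definition Dxm :: "('i::ring_1 \<Rightarrow> 'i \<Rightarrow> real) \<Rightarrow> 'i \<Rightarrow> 'i \<Rightarrow> real" where
  "Dxm \<phi> x y = \<phi> x y - \<phi> (x - 1) y"

definition Dxx :: "('i::ring_1 \<Rightarrow> 'i \<Rightarrow> real) \<Rightarrow> 'i \<Rightarrow> 'i \<Rightarrow> real" where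
  "Dxx \<phi> x y = \<phi> (x + 1) y - 2 * \<phi> x y + \<phi> (x - 1) y"

definition Dyp :: "('i::ring_1 \<Rightarrow> 'i \<Rightarrow> real) \<Rightarrow> 'i \<Rightarrow> 'i \<Rightarrow> real" where
  "Dyp \<phi> x y = \<phi> x (y + 1) - \<phi> x y"

definition Dym :: "('i::ring_1 \<Rightarrow> 'i \<Rightarrow> real) \<Rightarrow> 'i \<Rightarrow> 'i \<Rightarrow> real" where
  "Dym \<phi> x y = \<phi> x y - \<phi> x (y - 1)"

definition Dyy :: "('i::ring_1 \<Rightarrow> 'i \<Rightarrow> real) \<Rightarrow> 'i \<Rightarrow> 'i \<Rightarrow> real" where
  "Dyy \<phi> x y = \<phi> x (y + 1) - 2 * \<phi> x y + \<phi> x (y - 1)"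

definition lattice_laplacian :: "('i::ring_1 \<Rightarrow> 'i \<Rightarrow> real) \<Rightarrow> 'i \<Rightarrow> 'i \<Rightarrow> real" where
  "lattice_laplacian \<phi> x y = Dxx \<phi> x y + Dyy \<phi> x y"

definition laplacian_symbol :: "real \<Rightarrow> real \<Rightarrow> real" where
  "laplacian_symbol \<theta>1 \<theta>2 = 2 * cos \<theta>1 + 2 * cos \<theta>2 - 4"

text \<open>
  The integrand is singular only at the origin, where it is bounded by a multiple of
  \<open>1 / norm \<theta>\<close>; it is absolutely integrable, so a Lebesgue integral suffices.
\<close>

definition laplace_green_reg :: "int \<Rightarrow> int \<Rightarrow> complex" where
  "laplace_green_reg m1 m2 =
     1 / (4 * of_real pi ^ 2) *
     (LINT \<theta> : {-pi..pi} \<times> {-pi..pi} | lborel.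
        (exp (\<i> * of_real (of_int m1 * fst \<theta> + of_int m2 * snd \<theta>)) - 1) /
        of_real (laplacian_symbol (fst \<theta>) (snd \<theta>)))"

text \<open>
  The finite-part integral determines the Green's function up to an additive constant; every
  choice of that constant is admitted.
\<close>

definition laplace_lattice_green :: "(int \<Rightarrow> int \<Rightarrow> real) \<Rightarrow> bool" where
  "laplace_lattice_green G \<longleftrightarrow>
     (\<exists>c::real. \<forall>m1 m2. complex_of_real (G m1 m2) = laplace_green_reg m1 m2 + complex_of_real c)"

text \<open>
  The integral is real, so the equation between complex numbers above can be satisfied.
\<close>

lemma Im_laplace_green_reg: "Im (laplace_green_reg m1 m2) = 0"
proof -
  define f where "f = (\<lambda>\<theta>::real \<times> real. indicator ({-pi..pi} \<times> {-pi..pi}) \<theta> *\<^sub>R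
     ((exp (\<i> * of_real (of_int m1 * fst \<theta> + of_int m2 * snd \<theta>)) - 1) /
        complex_of_real (laplacian_symbol (fst \<theta>) (snd \<theta>))))"
  have m: "f \<in> borel_measurable lborel"
    unfolding f_def laplacian_symbol_def
    by (intro borel_measurable_scaleR borel_measurable_indicator borel_measurable_divide)
       (auto intro!: borel_measurable_continuous_onI continuous_intros borel_closed closed_Times)
  have refl: "(lborel :: (real \<times> real) measure) = distr lborel borel uminus"
    using lborel_affine[of "-1" "0 :: real \<times> real"] by (simp add: density_1)
  have "(LINT \<theta>|lborel. f \<theta>) = (LINT \<theta>|lborel. f (- \<theta>))"
    by (subst refl, rule integral_distr) (use m in auto)
  also have "\<dots> = (LINT \<theta>|lborel. cnj (f \<theta>))"
    by (rule Bochner_Integration.integral_cong)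
       (auto simp: f_def laplacian_symbol_def exp_cnj algebra_simps split: split_indicator)
  also have "\<dots> = cnj (LINT \<theta>|lborel. f \<theta>)"
    by (rule Bochner_Integration.integral_cnj)
  finally have "(LINT \<theta>|lborel. f \<theta>) \<in> \<real>"
    by (metis Reals_cnj_iff)
  moreover have "laplace_green_reg m1 m2 = 1 / (4 * of_real pi ^ 2) * (LINT \<theta>|lborel. f \<theta>)"
    unfolding laplace_green_reg_def set_lebesgue_integral_def f_def ..
  ultimately have "laplace_green_reg m1 m2 \<in> \<real>"
    by simp
  then show ?thesis
    by (simp add: complex_is_Real_iff)
qed

definition biharmonic_lattice_green ::
    "(int \<Rightarrow> int \<Rightarrow> real) \<Rightarrow> (int \<Rightarrow> int \<Rightarrow> real) \<Rightarrow> bool" where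
  "biharmonic_lattice_green G H \<longleftrightarrow> (\<forall>m1 m2. lattice_laplacian H m1 m2 = G m1 m2)"

text \<open>
  Velocities and forces are functions of the real coordinates of a node, of which only the values
  at the nodes \<open>(m1 + 1/2, m2)\<close> respectively \<open>(m1, m2 + 1/2)\<close> matter; the pressure is a function
  on the integer lattice.
\<close>

definition horizontal_nodes :: "(real \<times> real) set" where
  "horizontal_nodes = {(of_int m1 + 1/2, of_int m2) | m1 m2 :: int. True}"

definition vertical_nodes :: "(real \<times> real) set" where
  "vertical_nodes = {(of_int m1, of_int m2 + 1/2) | m1 m2 :: int. True}"

definition mac_stokes ::
    "real \<Rightarrow> real \<Rightarrow> (real \<Rightarrow> real \<Rightarrow> real) \<Rightarrow> (real \<Rightarrow> real \<Rightarrow> real) \<Rightarrow>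
     (real \<Rightarrow> real \<Rightarrow> real) \<Rightarrow> (real \<Rightarrow> real \<Rightarrow> real) \<Rightarrow> (int \<Rightarrow> int \<Rightarrow> real) \<Rightarrow> bool" where
  "mac_stokes h \<mu> fu fv u v p \<longleftrightarrow>
     (\<forall>m1 m2 :: int.
        - \<mu> * lattice_laplacian u (of_int m1 + 1/2) (of_int m2) + h * (p (m1 + 1) m2 - p m1 m2)
          = h\<^sup>2 * fu (of_int m1 + 1/2) (of_int m2) \<and>
        - \<mu> * lattice_laplacian v (of_int m1) (of_int m2 + 1/2) + h * (p m1 (m2 + 1) - p m1 m2)
          = h\<^sup>2 * fv (of_int m1) (of_int m2 + 1/2) \<and>
        u (of_int m1 + 1/2) (of_int m2) - u (of_int m1 - 1/2) (of_int m2)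
          + v (of_int m1) (of_int m2 + 1/2) - v (of_int m1) (of_int m2 - 1/2) = 0)"

definition unit_force_x :: "real \<Rightarrow> (real \<Rightarrow> real \<Rightarrow> real) \<Rightarrow> (real \<Rightarrow> real \<Rightarrow> real) \<Rightarrow> bool" where
  "unit_force_x h fu fv \<longleftrightarrow>
     (\<forall>(x, y) \<in> horizontal_nodes. h\<^sup>2 * fu x y = (if (x, y) = (1/2, 0) then 1 else 0)) \<and>
     (\<forall>(x, y) \<in> vertical_nodes. fv x y = 0)"

definition unit_force_y :: "real \<Rightarrow> (real \<Rightarrow> real \<Rightarrow> real) \<Rightarrow> (real \<Rightarrow> real \<Rightarrow> real) \<Rightarrow> bool" where
  "unit_force_y h fu fv \<longleftrightarrow>
     (\<forall>(x, y) \<in> vertical_nodes. h\<^sup>2 * fv x y = (if (x, y) = (0, 1/2) then 1 else 0)) \<and>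
     (\<forall>(x, y) \<in> horizontal_nodes. fu x y = 0)"

definition velocity_green :: "real \<Rightarrow> (int \<Rightarrow> int \<Rightarrow> real) \<Rightarrow> int \<Rightarrow> int \<Rightarrow> real^2^2" where
  "velocity_green \<mu> H m1 m2 = (- 1 / \<mu>) *\<^sub>R
     vector [vector [Dyy H m1 m2, - Dyp (Dxp H) m1 (m2 - 1)],
             vector [- Dyp (Dxp H) (m1 - 1) m2, Dxx H m1 m2]]"

definition pressure_green :: "real \<Rightarrow> (int \<Rightarrow> int \<Rightarrow> real) \<Rightarrow> int \<Rightarrow> int \<Rightarrow> real^2" where
  "pressure_green h G m1 m2 = (1 / h) *\<^sub>R vector [Dxm G m1 m2, Dym G m1 m2]"

end

theory Submission
  imports Defs
begin

text \<open>
  Away from \<open>\<theta> = 0\<close>, applying \<open>L\<close> in \<open>m\<close> to \<open>(exp (\<i> m\<cdot>\<theta>) - 1) / \<lambda>(\<theta>)\<close> leaves the plain character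
  \<open>exp (\<i> m\<cdot>\<theta>)\<close>, whose integral over the square is \<open>4 \<pi>\<^sup>2 \<delta>(m)\<close>; hence \<open>L G = \<delta>\<close>. Splitting the
  integral this way needs integrability at the origin, where the integrand is at most a constant
  times \<open>1 / (\<bar>\<theta>\<^sub>1\<bar> + \<bar>\<theta>\<^sub>2\<bar>) \<le> 1 / (2 \<surd>\<bar>\<theta>\<^sub>1\<bar> \<surd>\<bar>\<theta>\<^sub>2\<bar>)\<close>, a product of integrable functions of one variable.
  Given \<open>L G = \<delta>\<close>, the Stokes equations are identities between commuting difference operators.
\<close>

section \<open>Fubini for products and one-variable power singularities\<close>

text \<open>The field is generic because the lemma serves both the real dominating function and the
  complex characters.\<close>

lemma
  fixes f g :: "real \<Rightarrow> 'a::{real_normed_field, banach, second_countable_topology}"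
  assumes f: "integrable lborel f" and g: "integrable lborel g"
  shows integrable_lborel_times: "integrable lborel (\<lambda>z. f (fst z) * g (snd z))"
    and integral_lborel_times:
      "(LINT z|lborel. f (fst z) * g (snd z)) = (LINT x|lborel. f x) * (LINT y|lborel. g y)"
proof -
  have [measurable]: "f \<in> borel_measurable borel" "g \<in> borel_measurable borel"
    using borel_measurable_integrable[OF f] borel_measurable_integrable[OF g] by auto
  have int: "integrable (lborel \<Otimes>\<^sub>M lborel) (\<lambda>z. f (fst z) * g (snd z))"
    by (rule lborel_pair.Fubini_integrable) (use f g in \<open>auto simp: norm_mult\<close>)
  then show "integrable lborel (\<lambda>z. f (fst z) * g (snd z))"
    by (simp add: lborel_prod)
  show "(LINT z|lborel. f (fst z) * g (snd z)) = (LINT x|lborel. f x) * (LINT y|lborel. g y)"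
    using lborel_pair.integral_fst'[OF int] by (simp add: lborel_prod)
qed

lemma integrable_abs_powr:
  fixes a c :: real
  assumes "a > -1" "c \<ge> 0"
  shows "integrable lborel (\<lambda>x. indicator {-c..c} x * \<bar>x\<bar> powr a)"
proof -
  define g where "g = (\<lambda>x. indicator {0..c} x *\<^sub>R x powr a)"
  \<comment> \<open>For a nonnegative function gauge integrability gives absolute integrability;
    measurability then lets \<open>lebesgue\<close> be replaced by \<open>lborel\<close>.\<close>
  have "set_integrable lebesgue {0..c} (\<lambda>x. x powr a)"
    using integrable_on_powr_from_0[OF assms]
    by (intro nonnegative_absolutely_integrable_1) auto
  then have g: "integrable lborel g"
    unfolding set_integrable_def g_def by (subst (asm) integrable_completion) auto
  then have "integrable lborel (\<lambda>x. g (- x))"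
    using lborel_integrable_real_affine[of g "-1" 0] by simp
  with g have "integrable lborel (\<lambda>x. g x + g (- x))"
    by (rule Bochner_Integration.integrable_add)
  \<comment> \<open>The two halves overlap at 0, harmlessly: \<open>0 powr a = 0\<close>.\<close>
  then show ?thesis
    by (rule integrable_cong_AE_imp)
       (auto simp: g_def abs_if split: split_indicator intro!: AE_I2)
qed

section \<open>Lower bound for the symbol and integrability at the origin\<close>

text \<open>Jordan's inequality: a concave function lies above its chord, here the one from 0 to
  \<open>pi / 2\<close>.\<close>

lemma sin_ge_two_pi:
  assumes "0 \<le> x" "x \<le> pi / 2"
  shows "2 * x / pi \<le> sin x"
proof -
  have "concave_on {0..pi} sin"
    by (rule f''_le0_imp_concave[where f' = cos and f'' = "\<lambda>x. - sin x"])
       (auto intro!: derivative_eq_intros sin_ge_zero)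
  from concave_onD[OF this, of "2 * x / pi" 0 "pi / 2"] show ?thesis
    using assms by (simp add: field_simps)
qed

text \<open>Jordan's inequality at \<open>\<bar>t\<bar> / 2\<close>, squared, combined with 1 - cos
  t = 2 sin(t/2)^2.\<close>

lemma one_minus_cos_ge:
  assumes "\<bar>t\<bar> \<le> pi"
  shows "2 * t\<^sup>2 / pi\<^sup>2 \<le> 1 - cos t"
proof -
  have "(\<bar>t\<bar> / pi)\<^sup>2 \<le> (sin (\<bar>t\<bar> / 2))\<^sup>2"
    using sin_ge_two_pi[of "\<bar>t\<bar> / 2"] assms by (intro power_mono) auto
  also have "\<dots> = (sin (t / 2))\<^sup>2"
    by (simp add: abs_if)
  finally show ?thesis
    using cos_double_sin[of "t / 2"] by (simp add: power_divide)
qed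

text \<open>On the square the symbol vanishes only at the origin, and there only to second
  order.\<close>

lemma laplacian_symbol_le:
  assumes "\<bar>x\<bar> \<le> pi" "\<bar>y\<bar> \<le> pi"
  shows "4 * (x\<^sup>2 + y\<^sup>2) / pi\<^sup>2 \<le> - laplacian_symbol x y"
  using one_minus_cos_ge[OF assms(1)] one_minus_cos_ge[OF assms(2)]
  unfolding laplacian_symbol_def by (simp add: add_divide_distrib)

definition green_integrand :: "int \<Rightarrow> int \<Rightarrow> real \<times> real \<Rightarrow> complex" where
  "green_integrand m1 m2 \<theta> = indicator ({-pi..pi} \<times> {-pi..pi}) \<theta> *\<^sub>R
     ((exp (\<i> * of_real (of_int m1 * fst \<theta> + of_int m2 * snd \<theta>)) - 1) /
        of_real (laplacian_symbol (fst \<theta>) (snd \<theta>)))"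

text \<open>The product form of the bound reduces integrability to one variable. The axes are
  excluded because the right side is 0 there, by \<open>0 powr (-1/2) = 0\<close>, while the
  integrand need not be.\<close>

lemma norm_green_integrand_le:
  assumes "x \<noteq> 0" "y \<noteq> 0"
  shows "norm (green_integrand m1 m2 (x, y)) \<le>
    (\<bar>of_int m1\<bar> + \<bar>of_int m2\<bar>) * pi\<^sup>2 / 4 *
      ((indicator {-pi..pi} x * \<bar>x\<bar> powr (-1/2)) * (indicator {-pi..pi} y * \<bar>y\<bar> powr (-1/2)))"
proof (cases "\<bar>x\<bar> \<le> pi \<and> \<bar>y\<bar> \<le> pi")
  case True
  define M t :: real
    where "M = \<bar>of_int m1\<bar> + \<bar>of_int m2\<bar>" and "t = of_int m1 * x + of_int m2 * y"
  define q where "q = sqrt \<bar>x\<bar> * sqrt \<bar>y\<bar>"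
  have M: "0 \<le> M" by (simp add: M_def)
  have q: "0 < q" using assms by (simp add: q_def)
  have pos: "0 < x\<^sup>2 + y\<^sup>2" using assms by (simp add: sum_power2_gt_zero_iff)
  have sym: "4 * (x\<^sup>2 + y\<^sup>2) / pi\<^sup>2 \<le> \<bar>laplacian_symbol x y\<bar>"
    using laplacian_symbol_le[of x y] True by simp
  \<comment> \<open>The left side equals 2 |sin(t/2)|.\<close>
  have "norm (exp (\<i> * of_real t) - 1) \<le> \<bar>t\<bar>"
    using abs_sin_x_le_abs_x[of "t / 2"] by (simp only: dist_exp_i_1)
  also have "\<bar>t\<bar> \<le> \<bar>of_int m1\<bar> * \<bar>x\<bar> + \<bar>of_int m2\<bar> * \<bar>y\<bar>"
    unfolding t_def by (metis abs_mult abs_triangle_ineq)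
  also have "\<dots> \<le> M * (\<bar>x\<bar> + \<bar>y\<bar>)"
    by (simp add: M_def algebra_simps)
  finally have num: "norm (exp (\<i> * of_real t) - 1) \<le> M * (\<bar>x\<bar> + \<bar>y\<bar>)" .
  \<comment> \<open>AM-GM separates the variables; with (|x| + |y|)^2 <= 2 (x^2 + y^2) it bounds the
    quotient (|x| + |y|) / (x^2 + y^2) by \<open>1 / q\<close>.\<close>
  have "2 * q \<le> \<bar>x\<bar> + \<bar>y\<bar>"
    using arith_geo_mean_sqrt[of "\<bar>x\<bar>" "\<bar>y\<bar>"] by (simp add: q_def real_sqrt_mult)
  then have "(\<bar>x\<bar> + \<bar>y\<bar>) * (2 * q) \<le> (\<bar>x\<bar> + \<bar>y\<bar>) * (\<bar>x\<bar> + \<bar>y\<bar>)"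
    by (intro mult_left_mono) auto
  also have "\<dots> \<le> 2 * (x\<^sup>2 + y\<^sup>2)"
    using sum_squares_bound[of "\<bar>x\<bar>" "\<bar>y\<bar>"] by (simp add: power2_eq_square algebra_simps)
  finally have geo: "(\<bar>x\<bar> + \<bar>y\<bar>) * q \<le> x\<^sup>2 + y\<^sup>2" by simp
  have "norm (green_integrand m1 m2 (x, y)) =
      norm (exp (\<i> * of_real t) - 1) / \<bar>laplacian_symbol x y\<bar>"
    using True by (auto simp: green_integrand_def norm_divide t_def indicator_def)
  also have "\<dots> \<le> M * (\<bar>x\<bar> + \<bar>y\<bar>) / (4 * (x\<^sup>2 + y\<^sup>2) / pi\<^sup>2)"
    using num sym pos M by (intro frac_le) auto
  also have "\<dots> = M * pi\<^sup>2 / 4 * ((\<bar>x\<bar> + \<bar>y\<bar>) / (x\<^sup>2 + y\<^sup>2))"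
    by (simp add: field_simps)
  also have "\<dots> \<le> M * pi\<^sup>2 / 4 * (1 / q)"
    using geo q pos M by (intro mult_left_mono) (auto simp: field_simps)
  also have "1 / q = \<bar>x\<bar> powr (-1/2) * \<bar>y\<bar> powr (-1/2)"
    using assms by (simp add: q_def powr_minus_divide powr_half_sqrt)
  finally show ?thesis
    using True by (auto simp: M_def indicator_def)
qed (auto simp: green_integrand_def indicator_def)

text \<open>The coordinate axes are null sets, seen slice by slice. This discards the points where
  the pointwise lemmas do not apply.\<close>

lemma AE_lborel_prod_nonzero: "AE z in (lborel :: (real \<times> real) measure). fst z \<noteq> 0 \<and> snd z \<noteq> 0"
proof -
  have "AE z in (lborel \<Otimes>\<^sub>M lborel). fst z \<noteq> (0::real) \<and> snd z \<noteq> (0::real)"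
  proof (rule lborel_pair.AE_pair_measure)
    show "AE x in lborel. AE y in lborel. fst (x, y) \<noteq> (0::real) \<and> snd (x, y) \<noteq> (0::real)"
      using AE_lborel_singleton[of "0::real"] by auto
  qed measurable
  then show ?thesis by (simp only: lborel_prod)
qed

lemma integrable_green_integrand: "integrable lborel (green_integrand m1 m2)"
proof (rule Bochner_Integration.integrable_bound)
  let ?g = "\<lambda>x::real. indicator {-pi..pi} x * \<bar>x\<bar> powr (-1/2)"
  show "integrable lborel (\<lambda>z. (\<bar>of_int m1\<bar> + \<bar>of_int m2\<bar>) * pi\<^sup>2 / 4 * (?g (fst z) * ?g (snd z)))"
    by (intro integrable_mult_right integrable_lborel_times integrable_abs_powr) auto
  show "AE z in lborel. norm (green_integrand m1 m2 z) \<le>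
      norm ((\<bar>of_int m1\<bar> + \<bar>of_int m2\<bar>) * pi\<^sup>2 / 4 * (?g (fst z) * ?g (snd z)))"
    using AE_lborel_prod_nonzero
  proof eventually_elim
    case (elim z)
    then show ?case
      using norm_green_integrand_le[of "fst z" "snd z" m1 m2]
      by (smt (verit) prod.collapse real_norm_def)
  qed
  show "green_integrand m1 m2 \<in> borel_measurable lborel"
    unfolding green_integrand_def laplacian_symbol_def
    by (intro borel_measurable_scaleR borel_measurable_indicator borel_measurable_divide)
       (auto intro!: borel_measurable_continuous_onI continuous_intros borel_closed closed_Times)
qed

section \<open>Orthogonality of characters\<close>

lemma
  fixes k :: int
  shows integrable_exp_period:
      "integrable lborel (\<lambda>x. indicator {-pi..pi} x *\<^sub>R exp (\<i> * of_real (of_int k * x)))"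
    and integral_exp_period:
      "(LINT x|lborel. indicator {-pi..pi} x *\<^sub>R exp (\<i> * of_real (of_int k * x))) =
        (if k = 0 then 2 * of_real pi else 0)"
proof -
  show "integrable lborel (\<lambda>x. indicator {-pi..pi} x *\<^sub>R exp (\<i> * of_real (of_int k * x)))"
    by (rule borel_integrable_compact) (auto intro!: continuous_intros)
  show "(LINT x|lborel. indicator {-pi..pi} x *\<^sub>R exp (\<i> * of_real (of_int k * x))) =
        (if k = 0 then 2 * of_real pi else 0)"
  proof (cases "k = 0")
    case True
    then show ?thesis by (simp add: scaleR_conv_of_real)
  next
    case False
    define F where "F = (\<lambda>x. exp (\<i> * of_real (of_int k * x)) / (\<i> * of_int k))"
    have "(F has_vector_derivative exp (\<i> * of_real (of_int k * x))) (at x within A)" for x A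
      unfolding F_def
      by (rule derivative_eq_intros has_vector_derivative_real_field refl | simp add: False)+
        (subst mult.commute[of _ \<i>], simp)
    then have "(LINT x|lborel. indicator {-pi..pi} x *\<^sub>R exp (\<i> * of_real (of_int k * x))) = F pi - F (- pi)"
      by (intro integral_FTC_Icc) (auto intro!: continuous_intros)
    \<comment> \<open>The exponents differ by 2 pi i k, so the antiderivative agrees at both
      endpoints.\<close>
    also have "exp (\<i> * of_real (of_int k * pi)) = exp (\<i> * of_real (of_int k * - pi))"
      by (simp add: exp_eq)
    then have "F pi - F (- pi) = 0"
      by (simp add: F_def)
    finally show ?thesis using False by simp
  qed
qed

text \<open>Both the indicator of the square and the character factor over the coordinates.\<close>

lemma integral_character_square:
  "(LINT \<theta>|lborel. indicator ({-pi..pi} \<times> {-pi..pi}) \<theta> *\<^sub>R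
      exp (\<i> * of_real (of_int m1 * fst \<theta> + of_int m2 * snd \<theta>))) =
    (if m1 = 0 \<and> m2 = 0 then 4 * of_real pi ^ 2 else 0)"
proof -
  let ?e = "\<lambda>k x. indicator {-pi..pi} x *\<^sub>R exp (\<i> * of_real (of_int k * x))"
  have "(LINT \<theta>|lborel. indicator ({-pi..pi} \<times> {-pi..pi}) \<theta> *\<^sub>R
      exp (\<i> * of_real (of_int m1 * fst \<theta> + of_int m2 * snd \<theta>))) =
    (LINT \<theta>|lborel. ?e m1 (fst \<theta>) * ?e m2 (snd \<theta>))"
    by (rule Bochner_Integration.integral_cong)
       (auto simp: indicator_def exp_add ring_distribs mem_Times_iff)
  also have "\<dots> = (LINT x|lborel. ?e m1 x) * (LINT x|lborel. ?e m2 x)"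
    by (rule integral_lborel_times; rule integrable_exp_period)
  finally show ?thesis
    by (simp only: integral_exp_period) (simp add: power2_eq_square)
qed

section \<open>The equation \<open>L G = \<delta>\<close>\<close>

text \<open>\<open>L\<close> annihilates the constant -1 and multiplies the character by the symbol,
  which then cancels. At the origin this fails: division by zero makes the left side 0, while the
  right side is 1.\<close>

lemma laplacian_green_integrand:
  assumes "fst \<theta> \<noteq> 0 \<and> snd \<theta> \<noteq> 0"
  shows "green_integrand (m1 + 1) m2 \<theta> + green_integrand (m1 - 1) m2 \<theta> +
      green_integrand m1 (m2 + 1) \<theta> + green_integrand m1 (m2 - 1) \<theta> -
      4 * green_integrand m1 m2 \<theta> =
    indicator ({-pi..pi} \<times> {-pi..pi}) \<theta> *\<^sub>R
      exp (\<i> * of_real (of_int m1 * fst \<theta> + of_int m2 * snd \<theta>))"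
proof (cases "\<theta> \<in> {-pi..pi} \<times> {-pi..pi}")
  case True
  obtain x y where \<theta>: "\<theta> = (x, y)" by (cases \<theta>)
  define E where "E = exp (\<i> * of_real (of_int m1 * x + of_int m2 * y))"
  define s where "s = complex_of_real (laplacian_symbol x y)"
  have "0 < 4 * (x\<^sup>2 + y\<^sup>2) / pi\<^sup>2"
    using assms \<theta> by (intro divide_pos_pos mult_pos_pos) (auto simp: sum_power2_gt_zero_iff)
  then have s: "s \<noteq> 0"
    using laplacian_symbol_le[of x y] True \<theta> unfolding s_def of_real_eq_0_iff by fastforce
  have euler: "exp (\<i> * of_real t) + exp (- (\<i> * of_real t)) = of_real (2 * cos t)" for t
    using cos_exp_eq[of "of_real t"] by (simp add: cos_of_real mult.commute)
  have shift: "exp (\<i> * of_real (of_int (m1 + 1) * x + of_int m2 * y)) = E * exp (\<i> * of_real x)"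
    "exp (\<i> * of_real (of_int (m1 - 1) * x + of_int m2 * y)) = E * exp (- (\<i> * of_real x))"
    "exp (\<i> * of_real (of_int m1 * x + of_int (m2 + 1) * y)) = E * exp (\<i> * of_real y)"
    "exp (\<i> * of_real (of_int m1 * x + of_int (m2 - 1) * y)) = E * exp (- (\<i> * of_real y))"
    by (simp_all add: E_def exp_add[symmetric] algebra_simps)
  \<comment> \<open>By \<open>euler\<close>, opposite shifts add up to the cosines of the
    symbol.\<close>
  have "E * exp (\<i> * of_real x) + E * exp (- (\<i> * of_real x)) +
      E * exp (\<i> * of_real y) + E * exp (- (\<i> * of_real y)) - 4 * E = E * s"
    unfolding s_def laplacian_symbol_def of_real_diff of_real_add euler[symmetric]
    by (simp add: algebra_simps)
  then have "(E * exp (\<i> * of_real x) - 1) / s + (E * exp (- (\<i> * of_real x)) - 1) / s +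
      (E * exp (\<i> * of_real y) - 1) / s + (E * exp (- (\<i> * of_real y)) - 1) / s - 4 * ((E - 1) / s) = E"
    using s by (simp add: divide_simps) (simp add: algebra_simps)
  then show ?thesis
    using True unfolding green_integrand_def \<theta> fst_conv snd_conv shift E_def[symmetric] s_def[symmetric]
    by simp
qed (simp add: green_integrand_def)

lemma laplace_green_reg_conv:
  "laplace_green_reg m1 m2 = 1 / (4 * of_real pi ^ 2) * (LINT \<theta>|lborel. green_integrand m1 m2 \<theta>)"
  unfolding laplace_green_reg_def set_lebesgue_integral_def green_integrand_def ..

lemma laplacian_laplace_green_reg:
  "laplace_green_reg (m1 + 1) m2 + laplace_green_reg (m1 - 1) m2 +
     laplace_green_reg m1 (m2 + 1) + laplace_green_reg m1 (m2 - 1) - 4 * laplace_green_reg m1 m2 =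
   (if m1 = 0 \<and> m2 = 0 then 1 else 0)"
proof -
  let ?J = "\<lambda>m1 m2. LINT \<theta>|lborel. green_integrand m1 m2 \<theta>"
  note [simp] = integrable_green_integrand
  have meas: "(\<lambda>\<theta>. indicator ({-pi..pi} \<times> {-pi..pi}) \<theta> *\<^sub>R
      exp (\<i> * of_real (of_int m1 * fst \<theta> + of_int m2 * snd \<theta>))) \<in> borel_measurable lborel"
    by (intro borel_measurable_scaleR borel_measurable_indicator)
       (auto intro!: borel_measurable_continuous_onI continuous_intros borel_closed closed_Times)
  \<comment> \<open>Linearity of the integral, legitimate because each of the five integrands is
    integrable.\<close>
  have "?J (m1 + 1) m2 + ?J (m1 - 1) m2 + ?J m1 (m2 + 1) + ?J m1 (m2 - 1) - 4 * ?J m1 m2 =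
    (LINT \<theta>|lborel. green_integrand (m1 + 1) m2 \<theta> + green_integrand (m1 - 1) m2 \<theta> +
      green_integrand m1 (m2 + 1) \<theta> + green_integrand m1 (m2 - 1) \<theta> -
      4 * green_integrand m1 m2 \<theta>)"
    by simp
  also have "\<dots> = (LINT \<theta>|lborel. indicator ({-pi..pi} \<times> {-pi..pi}) \<theta> *\<^sub>R
      exp (\<i> * of_real (of_int m1 * fst \<theta> + of_int m2 * snd \<theta>)))"
  proof (rule integral_cong_AE[OF _ meas])
    show "AE \<theta> in lborel. green_integrand (m1 + 1) m2 \<theta> + green_integrand (m1 - 1) m2 \<theta> +
      green_integrand m1 (m2 + 1) \<theta> + green_integrand m1 (m2 - 1) \<theta> -
      4 * green_integrand m1 m2 \<theta> = indicator ({-pi..pi} \<times> {-pi..pi}) \<theta> *\<^sub>R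
      exp (\<i> * of_real (of_int m1 * fst \<theta> + of_int m2 * snd \<theta>))"
      using AE_lborel_prod_nonzero by eventually_elim (rule laplacian_green_integrand)
  qed (intro borel_measurable_integrable, simp)
  finally have "?J (m1 + 1) m2 + ?J (m1 - 1) m2 + ?J m1 (m2 + 1) + ?J m1 (m2 - 1) - 4 * ?J m1 m2 =
    (if m1 = 0 \<and> m2 = 0 then 4 * of_real pi ^ 2 else 0)"
    by (simp only: integral_character_square)
  then show ?thesis
    unfolding laplace_green_reg_conv by (simp add: field_simps split: if_splits)
qed

text \<open>The free constant drops out because the coefficients of \<open>L\<close> sum to
  0.\<close>

lemma lattice_laplacian_green:
  assumes "laplace_lattice_green G"
  shows "lattice_laplacian G m1 m2 = (if m1 = 0 \<and> m2 = 0 then 1 else 0)"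
proof -
  obtain c where c: "complex_of_real (G a b) = laplace_green_reg a b + complex_of_real c" for a b
    using assms by (auto simp: laplace_lattice_green_def)
  have "complex_of_real (lattice_laplacian G m1 m2) = (if m1 = 0 \<and> m2 = 0 then 1 else 0)"
    using laplacian_laplace_green_reg[of m1 m2]
    by (simp add: lattice_laplacian_def Dxx_def Dyy_def c algebra_simps)
  also have "\<dots> = complex_of_real (if m1 = 0 \<and> m2 = 0 then 1 else 0)"
    by simp
  finally show ?thesis
    by (simp only: of_real_eq_iff)
qed

section \<open>The Stokes equations in integer indices\<close>

text \<open>Unit steps lead from nodes to nodes, so the values of \<open>u\<close> elsewhere do not
  enter.\<close>

lemma lattice_laplacian_horizontal:
  fixes u :: "real \<Rightarrow> real \<Rightarrow> real"
  assumes "\<And>m1 m2 :: int. u (of_int m1 + 1/2) (of_int m2) = U m1 m2"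
  shows "lattice_laplacian u (of_int m1 + 1/2) (of_int m2) = lattice_laplacian U m1 m2"
  using assms[of m1 m2] assms[of "m1 + 1" m2] assms[of "m1 - 1" m2]
    assms[of m1 "m2 + 1"] assms[of m1 "m2 - 1"]
  by (simp add: lattice_laplacian_def Dxx_def Dyy_def algebra_simps)

lemma lattice_laplacian_vertical:
  fixes v :: "real \<Rightarrow> real \<Rightarrow> real"
  assumes "\<And>m1 m2 :: int. v (of_int m1) (of_int m2 + 1/2) = V m1 m2"
  shows "lattice_laplacian v (of_int m1) (of_int m2 + 1/2) = lattice_laplacian V m1 m2"
  using assms[of m1 m2] assms[of "m1 + 1" m2] assms[of "m1 - 1" m2]
    assms[of m1 "m2 + 1"] assms[of m1 "m2 - 1"]
  by (simp add: lattice_laplacian_def Dxx_def Dyy_def algebra_simps)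

text \<open>Removes the half shifts. The left face of cell \<open>m1\<close> carries the index
  \<open>m1 - 1\<close>, so the divergence uses backward differences, while the pressure gradient
  uses forward ones.\<close>

lemma mac_stokesI:
  fixes U V :: "int \<Rightarrow> int \<Rightarrow> real"
  assumes u: "\<And>m1 m2 :: int. u (of_int m1 + 1/2) (of_int m2) = U m1 m2"
    and v: "\<And>m1 m2 :: int. v (of_int m1) (of_int m2 + 1/2) = V m1 m2"
    and fu: "\<And>m1 m2 :: int. h\<^sup>2 * fu (of_int m1 + 1/2) (of_int m2) =
      - \<mu> * lattice_laplacian U m1 m2 + h * Dxp p m1 m2"
    and fv: "\<And>m1 m2 :: int. h\<^sup>2 * fv (of_int m1) (of_int m2 + 1/2) =
      - \<mu> * lattice_laplacian V m1 m2 + h * Dyp p m1 m2"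
    and div: "\<And>m1 m2. Dxm U m1 m2 + Dym V m1 m2 = 0"
  shows "mac_stokes h \<mu> fu fv u v p"
proof -
  have "u (of_int m1 - 1/2) (of_int m2) = U (m1 - 1) m2" for m1 m2 :: int
    using u[of "m1 - 1" m2] by (simp add: algebra_simps)
  moreover have "v (of_int m1) (of_int m2 - 1/2) = V m1 (m2 - 1)" for m1 m2 :: int
    using v[of m1 "m2 - 1"] by (simp add: algebra_simps)
  ultimately show ?thesis
    using div fu fv unfolding mac_stokes_def Dxp_def Dyp_def Dxm_def Dym_def
      lattice_laplacian_horizontal[of u U, OF u] lattice_laplacian_vertical[of v V, OF v]
    by (simp add: u v add_diff_eq)
qed

lemma velocity_green_entries:
  "velocity_green \<mu> H m1 m2 $ 1 $ 1 = - Dyy H m1 m2 / \<mu>"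
  "velocity_green \<mu> H m1 m2 $ 1 $ 2 = Dyp (Dxp H) m1 (m2 - 1) / \<mu>"
  "velocity_green \<mu> H m1 m2 $ 2 $ 1 = Dyp (Dxp H) (m1 - 1) m2 / \<mu>"
  "velocity_green \<mu> H m1 m2 $ 2 $ 2 = - Dxx H m1 m2 / \<mu>"
  by (simp_all add: velocity_green_def)

lemma pressure_green_entries:
  "pressure_green h G m1 m2 $ 1 = Dxm G m1 m2 / h"
  "pressure_green h G m1 m2 $ 2 = Dym G m1 m2 / h"
  by (simp_all add: pressure_green_def)

lemma unit_force_x_nodes:
  assumes "unit_force_x h fu fv"
  shows "h\<^sup>2 * fu (of_int m1 + 1/2) (of_int m2) = (if m1 = 0 \<and> m2 = 0 then 1 else 0)"
    and "fv (of_int m1) (of_int m2 + 1/2) = 0"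
  using assms unfolding unit_force_x_def horizontal_nodes_def vertical_nodes_def by fastforce+

lemma unit_force_y_nodes:
  assumes "unit_force_y h fu fv"
  shows "h\<^sup>2 * fv (of_int m1) (of_int m2 + 1/2) = (if m1 = 0 \<and> m2 = 0 then 1 else 0)"
    and "fu (of_int m1 + 1/2) (of_int m2) = 0"
  using assms unfolding unit_force_y_def horizontal_nodes_def vertical_nodes_def by fastforce+

lemma biharmonic_latticeD:
  assumes "biharmonic_lattice_green G H"
  shows "G = lattice_laplacian H"
  using assms by (auto simp: biharmonic_lattice_green_def fun_eq_iff)

lemmas difference_defs = Dxp_def Dxm_def Dyp_def Dym_def Dxx_def Dyy_def lattice_laplacian_def

theorem theorem2p1:
  fixes h \<mu> :: real
    and G H :: "int \<Rightarrow> int \<Rightarrow> real"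
  assumes "h > 0" and "\<mu> > 0"
    and "laplace_lattice_green G"
    and "biharmonic_lattice_green G H"
  shows
    "(\<forall>fu fv u v :: real \<Rightarrow> real \<Rightarrow> real. \<forall>p :: int \<Rightarrow> int \<Rightarrow> real.
        unit_force_x h fu fv \<and>
        (\<forall>m1 m2 :: int.
           u (of_int m1 + 1/2) (of_int m2) = velocity_green \<mu> H m1 m2 $ 1 $ 1 \<and>
           v (of_int m1) (of_int m2 + 1/2) = velocity_green \<mu> H m1 m2 $ 2 $ 1 \<and>
           p m1 m2 = pressure_green h G m1 m2 $ 1)
        \<longrightarrow> mac_stokes h \<mu> fu fv u v p) \<and>
     (\<forall>fu fv u v :: real \<Rightarrow> real \<Rightarrow> real. \<forall>p :: int \<Rightarrow> int \<Rightarrow> real.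
        unit_force_y h fu fv \<and>
        (\<forall>m1 m2 :: int.
           u (of_int m1 + 1/2) (of_int m2) = velocity_green \<mu> H m1 m2 $ 1 $ 2 \<and>
           v (of_int m1) (of_int m2 + 1/2) = velocity_green \<mu> H m1 m2 $ 2 $ 2 \<and>
           p m1 m2 = pressure_green h G m1 m2 $ 2)
        \<longrightarrow> mac_stokes h \<mu> fu fv u v p)"
proof (intro conjI allI impI; elim conjE)
  note G = lattice_laplacian_green[OF assms(3)]
  note [simp] = velocity_green_entries pressure_green_entries
  have GH: "G = lattice_laplacian H"
    by (rule biharmonic_latticeD[OF assms(4)])
  {
    fix fu fv u v :: "real \<Rightarrow> real \<Rightarrow> real" and p :: "int \<Rightarrow> int \<Rightarrow> real"
    assume f: "unit_force_x h fu fv"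
      and fields: "\<forall>m1 m2 :: int.
           u (of_int m1 + 1/2) (of_int m2) = velocity_green \<mu> H m1 m2 $ 1 $ 1 \<and>
           v (of_int m1) (of_int m2 + 1/2) = velocity_green \<mu> H m1 m2 $ 2 $ 1 \<and>
           p m1 m2 = pressure_green h G m1 m2 $ 1"
    show "mac_stokes h \<mu> fu fv u v p"
    proof (rule mac_stokesI)
      fix m1 m2 :: int
      \<comment> \<open>These equations choose \<open>U\<close> and \<open>V\<close> in
        \<open>mac_stokesI\<close>.\<close>
      show "u (of_int m1 + 1/2) (of_int m2) = - Dyy H m1 m2 / \<mu>"
        "v (of_int m1) (of_int m2 + 1/2) = Dyp (Dxp H) (m1 - 1) m2 / \<mu>"
        using fields by auto
      have p: "p a b = Dxm G a b / h" for a b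
        using fields by simp
      \<comment> \<open>\<open>L\<close> commutes with \<open>Dyy\<close> and forward after backward
        difference is \<open>Dxx\<close>, so the sum is \<open>Dyy G + Dxx G\<close>. Expressing
        \<open>G\<close> through \<open>H\<close> leaves a linear identity between values of
        \<open>H\<close>.\<close>
      have "- \<mu> * lattice_laplacian (\<lambda>m1 m2. - Dyy H m1 m2 / \<mu>) m1 m2 + h * Dxp p m1 m2 =
          lattice_laplacian G m1 m2"
        using assms(1,2) by (simp add: p GH difference_defs field_simps)
      then show "h\<^sup>2 * fu (of_int m1 + 1/2) (of_int m2) =
          - \<mu> * lattice_laplacian (\<lambda>m1 m2. - Dyy H m1 m2 / \<mu>) m1 m2 + h * Dxp p m1 m2"
        by (simp only: G unit_force_x_nodes[OF f])
      \<comment> \<open>\<open>Dxp\<close> at \<open>m1 - 1\<close> is \<open>Dxm\<close> at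
        \<open>m1\<close>, so viscous term and pressure gradient cancel.\<close>
      show "h\<^sup>2 * fv (of_int m1) (of_int m2 + 1/2) =
          - \<mu> * lattice_laplacian (\<lambda>m1 m2. Dyp (Dxp H) (m1 - 1) m2 / \<mu>) m1 m2 + h * Dyp p m1 m2"
        using assms(1,2) unfolding unit_force_x_nodes[OF f]
        by (simp add: p GH difference_defs field_simps)
      \<comment> \<open>Both terms are \<open>Dxm\<close> of \<open>Dyy H\<close> up to sign, since
        \<open>Dym\<close> after \<open>Dyp\<close> is \<open>Dyy\<close>.\<close>
      show "Dxm (\<lambda>m1 m2. - Dyy H m1 m2 / \<mu>) m1 m2 +
          Dym (\<lambda>m1 m2. Dyp (Dxp H) (m1 - 1) m2 / \<mu>) m1 m2 = 0"
        using assms(2) by (simp add: difference_defs field_simps)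
    qed
  next
    fix fu fv u v :: "real \<Rightarrow> real \<Rightarrow> real" and p :: "int \<Rightarrow> int \<Rightarrow> real"
    assume f: "unit_force_y h fu fv"
      and fields: "\<forall>m1 m2 :: int.
           u (of_int m1 + 1/2) (of_int m2) = velocity_green \<mu> H m1 m2 $ 1 $ 2 \<and>
           v (of_int m1) (of_int m2 + 1/2) = velocity_green \<mu> H m1 m2 $ 2 $ 2 \<and>
           p m1 m2 = pressure_green h G m1 m2 $ 2"
    show "mac_stokes h \<mu> fu fv u v p"
    proof (rule mac_stokesI)
      fix m1 m2 :: int
      show "u (of_int m1 + 1/2) (of_int m2) = Dyp (Dxp H) m1 (m2 - 1) / \<mu>"
        "v (of_int m1) (of_int m2 + 1/2) = - Dxx H m1 m2 / \<mu>"
        using fields by auto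
      have p: "p a b = Dym G a b / h" for a b
        using fields by simp
      \<comment> \<open>The same cancellations with the axes exchanged; now the shift
        \<open>m2 - 1\<close> turns \<open>Dyp\<close> into \<open>Dym\<close>.\<close>
      have "- \<mu> * lattice_laplacian (\<lambda>m1 m2. - Dxx H m1 m2 / \<mu>) m1 m2 + h * Dyp p m1 m2 =
          lattice_laplacian G m1 m2"
        using assms(1,2) by (simp add: p GH difference_defs field_simps)
      then show "h\<^sup>2 * fv (of_int m1) (of_int m2 + 1/2) =
          - \<mu> * lattice_laplacian (\<lambda>m1 m2. - Dxx H m1 m2 / \<mu>) m1 m2 + h * Dyp p m1 m2"
        by (simp only: G unit_force_y_nodes[OF f])
      show "h\<^sup>2 * fu (of_int m1 + 1/2) (of_int m2) =
          - \<mu> * lattice_laplacian (\<lambda>m1 m2. Dyp (Dxp H) m1 (m2 - 1) / \<mu>) m1 m2 + h * Dxp p m1 m2"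
        using assms(1,2) unfolding unit_force_y_nodes[OF f]
        by (simp add: p GH difference_defs field_simps)
      show "Dxm (\<lambda>m1 m2. Dyp (Dxp H) m1 (m2 - 1) / \<mu>) m1 m2 +
          Dym (\<lambda>m1 m2. - Dxx H m1 m2 / \<mu>) m1 m2 = 0"
        using assms(2) by (simp add: difference_defs field_simps)
    qed
  }
qed

end
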